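(* There is a polynomial-time algorithm that, given a tournament graph $G=(V,E)$ on $m$ teams, a single-elimination cup $c$ with fixed, known seeding over the teams $V$, a coalition $C\subseteq V$, and a team $v_w\in V$, decides whether the cup competition can be constructively manipulated in favour of $v_w$, i.e. whether there is a set of manipulations of the tournament by $C$ after which $v_w$ wins the cup.
   Context: A tournament is a directed graph $G=(V,E)$ whose underlying undirected graph is complete, with exactly one directed edge between any two distinct teams; $(v_i,v_j)\in E$ means that $v_i$ beats $v_j$ in a fair game. The number of teams is $m=|V|$, and the tournament graph is known. A manipulation replaces an edge $(v_i,v_j)$ by $(v_j,v_i)$; it is allowed only if $v_i\in C$, i.e. coalition members may only throw games they would have won. A single-elimination cup with fixed seeding is a rooted binary tree in which every internal node has two children and whose leaves are labelled bijectively by the teams. Each internal node is a game between the winners of its two child subtrees (a leaf's winner is its team), decided by the (manipulated) tournament graph; the winner of the game at the root wins the cup. *)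

theory Defs
  imports "HOL-Computational_Algebra.Polynomial"
begin

section \<open>Tournaments, cups and manipulations\<close>

definition tournament :: "'v set \<Rightarrow> 'v rel \<Rightarrow> bool" where
  "tournament V E \<longleftrightarrow> finite V \<and> E \<subseteq> V \<times> V \<and> irrefl E \<and>
     (\<forall>u\<in>V. \<forall>v\<in>V. u \<noteq> v \<longrightarrow> ((u, v) \<in> E \<longleftrightarrow> (v, u) \<notin> E))"

datatype 'v cup = Team 'v | Game "'v cup" "'v cup"

fun leaves :: "'v cup \<Rightarrow> 'v list" where
  "leaves (Team v) = [v]"
| "leaves (Game l r) = leaves l @ leaves r"

definition cup_over :: "'v set \<Rightarrow> 'v cup \<Rightarrow> bool" where
  "cup_over V c \<longleftrightarrow> distinct (leaves c) \<and> set (leaves c) = V"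

fun winner :: "'v rel \<Rightarrow> 'v cup \<Rightarrow> 'v" where
  "winner E (Team v) = v"
| "winner E (Game l r) =
     (let a = winner E l; b = winner E r in if (a, b) \<in> E then a else b)"

definition manipulations :: "'v rel \<Rightarrow> 'v set \<Rightarrow> 'v rel set" where
  "manipulations E C = {M. M \<subseteq> E \<and> (\<forall>(u, v)\<in>M. u \<in> C)}"

definition manipulate :: "'v rel \<Rightarrow> 'v rel \<Rightarrow> 'v rel" where
  "manipulate E M = (E - M) \<union> M\<inverse>"

definition constructively_manipulable :: "'v rel \<Rightarrow> 'v cup \<Rightarrow> 'v set \<Rightarrow> 'v \<Rightarrow> bool" where
  "constructively_manipulable E c C w \<longleftrightarrow>
     (\<exists>M\<in>manipulations E C. winner (manipulate E M) c = w)"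

section \<open>Random access machines\<close>

text \<open>
  The machine model is the random access machine of Cook and Reckhow (Time bounded random access
  machines, 1973) over the natural numbers, with truncated subtraction and unit cost per
  instruction. There is no multiplication, so a number can grow by at most one bit per step
  and unit-cost time is polynomially related to Turing machine time.
\<close>

type_synonym reg = nat

datatype instr =
    Const reg nat
  | Add reg reg reg
  | Sub reg reg reg
  | Load reg reg   \<comment> \<open>\<open>Load i j\<close>: register \<open>i\<close> gets the content of the register addressed by register \<open>j\<close>\<close>
  | Store reg reg  \<comment> \<open>\<open>Store i j\<close>: the register addressed by register \<open>i\<close> gets the content of register \<open>j\<close>\<close>
  | Jump_pos reg nat
  | Read reg       \<comment> \<open>consumes the next input word, or yields 0 once the input is exhausted\<close>

type_synonym program = "instr list"

text \<open>A configuration consists of program counter, registers and unread input.\<close>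

type_synonym config = "nat \<times> (reg \<Rightarrow> nat) \<times> nat list"

fun exec :: "instr \<Rightarrow> config \<Rightarrow> config" where
  "exec (Const i n) (pc, s, xs) = (Suc pc, s(i := n), xs)"
| "exec (Add i j k) (pc, s, xs) = (Suc pc, s(i := s j + s k), xs)"
| "exec (Sub i j k) (pc, s, xs) = (Suc pc, s(i := s j - s k), xs)"
| "exec (Load i j) (pc, s, xs) = (Suc pc, s(i := s (s j)), xs)"
| "exec (Store i j) (pc, s, xs) = (Suc pc, s(s i := s j), xs)"
| "exec (Jump_pos i l) (pc, s, xs) = (if s i > 0 then l else Suc pc, s, xs)"
| "exec (Read i) (pc, s, []) = (Suc pc, s(i := 0), [])"
| "exec (Read i) (pc, s, x # xs) = (Suc pc, s(i := x), xs)"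

definition halted :: "program \<Rightarrow> config \<Rightarrow> bool" where
  "halted P cfg \<longleftrightarrow> fst cfg \<ge> length P"

definition step :: "program \<Rightarrow> config \<Rightarrow> config" where
  "step P cfg = (if halted P cfg then cfg else exec (P ! fst cfg) cfg)"

definition initial :: "nat list \<Rightarrow> config" where
  "initial xs = (0, \<lambda>_. 0, xs)"

text \<open>The answer is delivered in register 0 as a truth value 0 or 1.\<close>

definition answers_within :: "program \<Rightarrow> nat list \<Rightarrow> nat \<Rightarrow> bool \<Rightarrow> bool" where
  "answers_within P xs t b \<longleftrightarrow>
     (let cfg = (step P ^^ t) (initial xs)
      in halted P cfg \<and> fst (snd cfg) 0 = of_bool b)"

section \<open>Encoding of instances\<close>

text \<open>
  Teams are presented to the machine as the numbers \<open>0, \<dots>, m - 1\<close>, the graph by its adjacency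
  matrix (row by row), the coalition by its characteristic vector, and the cup in postfix notation,
  where 0 stands for a game and \<open>v + 1\<close> for the leaf labelled \<open>v\<close>. All words are at most \<open>m\<close>, so
  the number of words is polynomially related to the bit length of the input and to \<open>m\<close>.
\<close>

fun encode_cup :: "nat cup \<Rightarrow> nat list" where
  "encode_cup (Team v) = [Suc v]"
| "encode_cup (Game l r) = encode_cup l @ encode_cup r @ [0]"

definition encode_instance :: "nat \<Rightarrow> nat rel \<Rightarrow> nat cup \<Rightarrow> nat set \<Rightarrow> nat \<Rightarrow> nat list" where
  "encode_instance m E c C w =
     [m, w]
     @ concat (map (\<lambda>i. map (\<lambda>j. of_bool ((i, j) \<in> E)) [0..<m]) [0..<m])
     @ map (\<lambda>i. of_bool (i \<in> C)) [0..<m]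
     @ encode_cup c"

end

theory Submission
  imports Defs
begin

text \<open>Any two teams can meet in at most one game of the cup, and games in disjoint subcups use
  disjoint sets of edges. Hence the manipulations that let \<open>a\<close> win one subcup, \<open>b\<close> win the
  other and \<open>a\<close> win against \<open>b\<close> can be chosen independently, and the teams that can win a game are
  those that can win their own subcup and can be made to beat some possible winner of the other.
  Evaluating this recursion bottom-up takes \<open>O(m\<^sup>2)\<close> steps per game, also on a random access
  machine.\<close>

section \<open>Structured programs\<close>

text \<open>The claim concerns one fixed machine program, so the recursion must become concrete code
  with a verified step count. The code is written in a small structured language whose semantics
  \<open>runs\<close> counts machine steps exactly; reasoning about jump targets is confined to
  \<open>compile_correct\<close>, and \<open>ensures\<close> relaxes exact counts to upper bounds
  that compose. Disjointness of subcups is used twice: it makes the manipulations of the two sides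
  independent, and it lets a whole stack of sets of teams live in one array of \<open>m\<close>
  levels, since no team lies in two of the sets. The machine thus gets by without recursion or
  lists.\<close>

type_synonym state = "(reg \<Rightarrow> nat) \<times> nat list"

text \<open>\<open>Unless r c\<close> skips \<open>c\<close> if \<open>r\<close> is positive, and \<open>Repeat c r\<close> tests \<open>r\<close> after the body.
  In this form neither of the two needs an unconditional jump, which the machine lacks.\<close>

datatype cmd =
    Block "instr list"
  | Seq cmd cmd  (infixr ";;" 60)
  | Unless reg cmd
  | Repeat cmd reg

text \<open>Jump targets are absolute, so \<open>l\<close> is the address at which the code will be
  placed.\<close>

fun compile :: "nat \<Rightarrow> cmd \<Rightarrow> program" where
  "compile l (Block is) = is"
| "compile l (c1 ;; c2) = (let p = compile l c1 in p @ compile (l + length p) c2)"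
| "compile l (Unless r c) = (let p = compile (Suc l) c in Jump_pos r (Suc l + length p) # p)"
| "compile l (Repeat c r) = compile l c @ [Jump_pos r l]"

fun straight :: "instr \<Rightarrow> bool" where
  "straight (Jump_pos _ _) = False"
| "straight _ = True"

text \<open>Registers and input evolve independently of the program counter, so 0 is an arbitrary
  choice.\<close>

definition effect :: "instr \<Rightarrow> state \<Rightarrow> state" where
  "effect i \<sigma> = snd (exec i (0, \<sigma>))"

inductive runs :: "cmd \<Rightarrow> state \<Rightarrow> nat \<Rightarrow> state \<Rightarrow> bool" where
  Block: "list_all straight is \<Longrightarrow> runs (Block is) \<sigma> (length is) (fold effect is \<sigma>)"
| Seq: "runs c1 \<sigma> t1 \<sigma>1 \<Longrightarrow> runs c2 \<sigma>1 t2 \<sigma>2 \<Longrightarrow> runs (c1 ;; c2) \<sigma> (t1 + t2) \<sigma>2"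
| Unless_skip: "fst \<sigma> r > 0 \<Longrightarrow> runs (Unless r c) \<sigma> 1 \<sigma>"
| Unless_do: "fst \<sigma> r = 0 \<Longrightarrow> runs c \<sigma> t \<sigma>1 \<Longrightarrow> runs (Unless r c) \<sigma> (Suc t) \<sigma>1"
| Repeat_stop: "runs c \<sigma> t \<sigma>1 \<Longrightarrow> fst \<sigma>1 r = 0 \<Longrightarrow> runs (Repeat c r) \<sigma> (Suc t) \<sigma>1"
| Repeat_again: "runs c \<sigma> t1 \<sigma>1 \<Longrightarrow> fst \<sigma>1 r > 0 \<Longrightarrow> runs (Repeat c r) \<sigma>1 t2 \<sigma>2 \<Longrightarrow>
    runs (Repeat c r) \<sigma> (Suc t1 + t2) \<sigma>2"

section \<open>Correctness of the compilation\<close>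

lemma exec_straight:
  assumes "straight i"
  shows "exec i (pc, \<sigma>) = (Suc pc, effect i \<sigma>)"
proof -
  obtain s xs where "\<sigma> = (s, xs)" by (cases \<sigma>)
  with assms show ?thesis
    by (cases i; cases xs) (auto simp: effect_def)
qed

lemma steps_straight:
  assumes "list_all straight is"
  shows "(step (pre @ is @ post) ^^ length is) (length pre, \<sigma>)
    = (length pre + length is, fold effect is \<sigma>)"
  using assms
proof (induction "is" arbitrary: pre \<sigma>)
  case (Cons i "is")
  have "step (pre @ (i # is) @ post) (length pre, \<sigma>) = (Suc (length pre), effect i \<sigma>)"
    using Cons.prems by (simp add: step_def halted_def exec_straight)
  with Cons.IH[of "pre @ [i]" "effect i \<sigma>"] Cons.prems show ?case
    by (simp add: funpow_Suc_right del: funpow.simps)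
qed simp

lemma steps_jump:
  "step (pre @ Jump_pos r l # post) (length pre, \<sigma>)
    = (if fst \<sigma> r > 0 then l else Suc (length pre), \<sigma>)"
  by (cases \<sigma>) (simp add: step_def halted_def)

lemma steps_trans:
  assumes "(step P ^^ t1) cfg1 = cfg2" "(step P ^^ t2) cfg2 = cfg3"
  shows "(step P ^^ (t1 + t2)) cfg1 = cfg3"
  using assms by (simp add: funpow_add add.commute[of t1])

text \<open>Arbitrary \<open>pre\<close> and \<open>post\<close> let the induction place a command
  inside larger code. The backward jump of \<open>Repeat\<close> lands at \<open>length pre\<close>
  again, so the remaining iterations are an instance of the induction hypothesis for the same
  surroundings.\<close>

lemma compile_correct:
  assumes "runs c \<sigma> t \<sigma>1"
  shows "(step (pre @ compile (length pre) c @ post) ^^ t) (length pre, \<sigma>)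
    = (length pre + length (compile (length pre) c), \<sigma>1)"
  using assms
proof (induction arbitrary: pre post rule: runs.induct)
  case (Block "is" \<sigma>)
  then show ?case using steps_straight by simp
next
  case (Seq c1 \<sigma> t1 \<sigma>1 c2 t2 \<sigma>2)
  let ?p = "compile (length pre) c1"
  let ?q = "compile (length pre + length ?p) c2"
  have "(step (pre @ ?p @ ?q @ post) ^^ (t1 + t2)) (length pre, \<sigma>)
    = (length pre + length ?p + length ?q, \<sigma>2)"
    using Seq.IH(1)[of pre "?q @ post"] Seq.IH(2)[of "pre @ ?p" post]
    by (intro steps_trans) simp_all
  then show ?case by (simp add: Let_def)
next
  case (Unless_skip \<sigma> r c)
  then show ?case by (simp add: Let_def steps_jump)
next
  case (Unless_do \<sigma> r c t \<sigma>1)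
  let ?p = "compile (Suc (length pre)) c"
  let ?j = "Jump_pos r (Suc (length pre) + length ?p)"
  have "(step (pre @ ?j # ?p @ post) ^^ (1 + t)) (length pre, \<sigma>)
    = (Suc (length pre) + length ?p, \<sigma>1)"
    using Unless_do.IH[of "pre @ [?j]" post] Unless_do.hyps
    by (intro steps_trans) (simp_all add: steps_jump)
  then show ?case by (simp add: Let_def)
next
  case (Repeat_stop c \<sigma> t \<sigma>1 r)
  let ?p = "compile (length pre) c"
  let ?P = "pre @ ?p @ Jump_pos r (length pre) # post"
  have "(step ?P ^^ (t + 1)) (length pre, \<sigma>) = (Suc (length pre + length ?p), \<sigma>1)"
    using Repeat_stop.IH[of pre "Jump_pos r (length pre) # post"]
      steps_jump[of "pre @ ?p" r "length pre" post \<sigma>1] Repeat_stop.hyps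
    by (intro steps_trans) simp_all
  then show ?case by simp
next
  case (Repeat_again c \<sigma> t1 \<sigma>1 r t2 \<sigma>2)
  let ?p = "compile (length pre) c"
  let ?P = "pre @ ?p @ Jump_pos r (length pre) # post"
  have "(step ?P ^^ (t1 + (1 + t2))) (length pre, \<sigma>) = (Suc (length pre + length ?p), \<sigma>2)"
    using Repeat_again.IH(1)[of pre "Jump_pos r (length pre) # post"]
      Repeat_again.IH(2)[of pre post]
      steps_jump[of "pre @ ?p" r "length pre" post \<sigma>1] Repeat_again.hyps
    by (intro steps_trans) simp_all
  then show ?case by simp
qed

section \<open>Total correctness with time bounds\<close>

definition ensures :: "cmd \<Rightarrow> state \<Rightarrow> nat \<Rightarrow> (state \<Rightarrow> bool) \<Rightarrow> bool" where
  "ensures c \<sigma> t Q \<longleftrightarrow> (\<exists>t' \<sigma>'. t' \<le> t \<and> runs c \<sigma> t' \<sigma>' \<and> Q \<sigma>')"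

lemma ensures_weaken:
  assumes "ensures c \<sigma> t Q" "t \<le> t'" "\<And>\<tau>. Q \<tau> \<Longrightarrow> Q' \<tau>"
  shows "ensures c \<sigma> t' Q'"
  using assms unfolding ensures_def by (meson order_trans)

lemma ensures_Block:
  assumes "Q (fold effect is \<sigma>)" "list_all straight is" "length is \<le> t"
  shows "ensures (Block is) \<sigma> t Q"
  using assms unfolding ensures_def by (meson runs.Block)

lemma ensures_Seq:
  assumes "ensures c1 \<sigma> t1 R" "\<And>\<tau>. R \<tau> \<Longrightarrow> ensures c2 \<tau> t2 Q" "t1 + t2 \<le> t"
  shows "ensures (c1 ;; c2) \<sigma> t Q"
  using assms unfolding ensures_def by (meson add_mono order_trans runs.Seq)

lemma ensures_Unless:
  assumes "fst \<sigma> r > 0 \<Longrightarrow> Q \<sigma>" "fst \<sigma> r = 0 \<Longrightarrow> ensures c \<sigma> t Q" "Suc t \<le> t'"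
  shows "ensures (Unless r c) \<sigma> t' Q"
proof (cases "fst \<sigma> r = 0")
  case True
  with assms show ?thesis unfolding ensures_def by (meson Suc_le_mono order_trans runs.Unless_do)
next
  case False
  have "1 \<le> t'" using assms(3) by simp
  with False assms(1) show ?thesis unfolding ensures_def using runs.Unless_skip by blast
qed

text \<open>The index of \<open>I\<close> is the number of iterations still to run. As the test
  follows the body, there is at least one; each costs one step beyond the body, for the
  jump.\<close>

lemma ensures_Repeat:
  assumes "\<And>k \<sigma>. I (Suc k) \<sigma> \<Longrightarrow> ensures c \<sigma> t (\<lambda>\<tau>. I k \<tau> \<and> fst \<tau> r = k)"
    and "I (Suc n) \<sigma>" "\<And>\<tau>. I 0 \<tau> \<Longrightarrow> Q \<tau>" "Suc n * Suc t \<le> t'"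
  shows "ensures (Repeat c r) \<sigma> t' Q"
proof -
  have "ensures (Repeat c r) \<sigma> (Suc n * Suc t) (I 0)"
    using assms(2)
  proof (induction n arbitrary: \<sigma>)
    case 0
    from assms(1)[OF 0] obtain t1 \<tau>
      where 1: "t1 \<le> t" "runs c \<sigma> t1 \<tau>" "I 0 \<tau>" "fst \<tau> r = 0"
      unfolding ensures_def by blast
    have "runs (Repeat c r) \<sigma> (Suc t1) \<tau>"
      using 1(2,4) by (rule runs.Repeat_stop)
    moreover have "Suc t1 \<le> Suc 0 * Suc t"
      using 1(1) by simp
    ultimately show ?case using 1(3) unfolding ensures_def by blast
  next
    case (Suc n)
    from assms(1)[OF Suc.prems] obtain t1 \<tau>
      where 1: "t1 \<le> t" "runs c \<sigma> t1 \<tau>" "I (Suc n) \<tau>" "fst \<tau> r = Suc n"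
      unfolding ensures_def by blast
    from Suc.IH[OF 1(3)] obtain t2 \<upsilon>
      where 2: "t2 \<le> Suc n * Suc t" "runs (Repeat c r) \<tau> t2 \<upsilon>" "I 0 \<upsilon>"
      unfolding ensures_def by blast
    have "runs (Repeat c r) \<sigma> (Suc t1 + t2) \<upsilon>"
      using 1(2,4) 2(2) by (intro runs.Repeat_again) simp_all
    moreover have "Suc t1 + t2 \<le> Suc (Suc n) * Suc t"
      using 1(1) 2(1) by simp
    ultimately show ?case using 2(3) unfolding ensures_def by blast
  qed
  then show ?thesis by (rule ensures_weaken) (use assms in auto)
qed

section \<open>Possible winners\<close>

text \<open>For distinct teams \<open>(a, b) \<notin> E\<close> means that \<open>b\<close> beats \<open>a\<close>, so that \<open>b \<in> C\<close> may throw the game.\<close>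

definition may_beat :: "'v rel \<Rightarrow> 'v set \<Rightarrow> 'v \<Rightarrow> 'v \<Rightarrow> bool" where
  "may_beat E C a b \<longleftrightarrow> (a, b) \<in> E \<or> b \<in> C"

fun possible_winners :: "'v rel \<Rightarrow> 'v set \<Rightarrow> 'v cup \<Rightarrow> 'v set" where
  "possible_winners E C (Team v) = {v}"
| "possible_winners E C (Game l r) =
     {a \<in> possible_winners E C l. \<exists>b\<in>possible_winners E C r. may_beat E C a b} \<union>
     {b \<in> possible_winners E C r. \<exists>a\<in>possible_winners E C l. may_beat E C b a}"

lemma possible_winners_subset: "possible_winners E C c \<subseteq> set (leaves c)"
  by (induction c) auto

lemma winner_in_leaves: "winner E c \<in> set (leaves c)"
  by (induction c) (auto simp: Let_def)

text \<open>Every game of \<open>c\<close> is between two of its leaves. Hence a subcup does not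
  notice manipulations of any other edges.\<close>

lemma winner_cong:
  assumes "\<And>u v. u \<in> set (leaves c) \<Longrightarrow> v \<in> set (leaves c) \<Longrightarrow> (u, v) \<in> E \<longleftrightarrow> (u, v) \<in> E'"
  shows "winner E c = winner E' c"
  using assms
proof (induction c)
  case (Game l r)
  then have "winner E l = winner E' l" "winner E r = winner E' r" by auto
  then show ?case
    using Game.prems[of "winner E l" "winner E r"] winner_in_leaves[of E l] winner_in_leaves[of E r]
    by (auto simp: Let_def)
qed simp

text \<open>An edge present after the manipulation is original or the reverse of a thrown game; by
  completeness of the tournament, an absent one means the same for the opposite edge. Either way
  \<open>may_beat\<close> holds for the actual winner.\<close>

lemma winner_possible:
  assumes "tournament V E" "M \<in> manipulations E C" "distinct (leaves c)" "set (leaves c) \<subseteq> V"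
  shows "winner (manipulate E M) c \<in> possible_winners E C c"
  using assms(3,4)
proof (induction c)
  case (Game l r)
  let ?a = "winner (manipulate E M) l" and ?b = "winner (manipulate E M) r"
  have ab: "?a \<in> possible_winners E C l" "?b \<in> possible_winners E C r"
    using Game by auto
  have mem: "?a \<in> set (leaves l)" "?b \<in> set (leaves r)"
    by (rule winner_in_leaves)+
  then have "?a \<noteq> ?b" "?a \<in> V" "?b \<in> V"
    using Game.prems by auto
  then have cases: "(?a, ?b) \<in> E \<or> (?b, ?a) \<in> E"
    using assms(1) unfolding tournament_def by metis
  show ?case
  proof (cases "(?a, ?b) \<in> manipulate E M")
    case True
    then have "may_beat E C ?a ?b"
      using assms(2) by (auto simp: manipulate_def manipulations_def may_beat_def)
    with True ab show ?thesis by (auto simp: Let_def)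
  next
    case False
    then have "may_beat E C ?b ?a"
      using assms(2) cases by (auto simp: manipulate_def manipulations_def may_beat_def)
    with False ab show ?thesis by (auto simp: Let_def)
  qed
qed simp

text \<open>Confining \<open>M\<close> to the teams of the subcup strengthens the induction: the
  manipulations for the two sides and for the final game then touch pairwise disjoint sets of
  edges.\<close>

lemma possible_winner_wins:
  assumes "tournament V E" "distinct (leaves c)" "set (leaves c) \<subseteq> V"
    and "w \<in> possible_winners E C c"
  shows "\<exists>M\<in>manipulations E C. M \<subseteq> set (leaves c) \<times> set (leaves c) \<and>
    winner (manipulate E M) c = w"
  using assms(2-)
proof (induction c arbitrary: w)
  case (Team v)
  then show ?case by (auto simp: manipulations_def)
next
  case (Game l r)
  let ?L = "set (leaves l)" and ?R = "set (leaves r)"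
  have disj: "?L \<inter> ?R = {}" and sub: "?L \<subseteq> V" "?R \<subseteq> V"
    using Game.prems by auto
  from Game.prems(3) obtain a b where ab: "a \<in> possible_winners E C l" "b \<in> possible_winners E C r"
    and w: "w = a \<and> may_beat E C a b \<or> w = b \<and> may_beat E C b a"
    by auto
  have abLR: "a \<in> ?L" "b \<in> ?R"
    using ab possible_winners_subset by fast+
  then have ne: "a \<noteq> b" and "a \<in> V" "b \<in> V"
    using disj sub by auto
  then have edge: "(a, b) \<in> E \<longleftrightarrow> (b, a) \<notin> E"
    using assms(1) unfolding tournament_def by metis
  have "distinct (leaves l)" "distinct (leaves r)"
    using Game.prems(1) by auto
  note IH = Game.IH(1)[OF this(1) sub(1) ab(1)] Game.IH(2)[OF this(2) sub(2) ab(2)]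
  from IH(1) obtain Ml where
    Ml: "Ml \<in> manipulations E C" "Ml \<subseteq> ?L \<times> ?L" "winner (manipulate E Ml) l = a"
    by blast
  from IH(2) obtain Mr where
    Mr: "Mr \<in> manipulations E C" "Mr \<subseteq> ?R \<times> ?R" "winner (manipulate E Mr) r = b"
    by blast
  \<comment> \<open>Intersecting with \<open>E\<close> throws the final game only if
    \<open>w\<close> would lose it; in that case \<open>may_beat\<close> puts the opponent into
    \<open>C\<close>.\<close>
  define T where "T = (if w = a then {(b, a)} else {(a, b)}) \<inter> E"
  define M where "M = Ml \<union> Mr \<union> T"
  have T: "T \<subseteq> {(a, b), (b, a)}"
    by (auto simp: T_def)
  have "\<forall>(u, v)\<in>T. u \<in> C"
    using w ne edge by (auto simp: T_def may_beat_def split: if_splits)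
  then have M: "M \<in> manipulations E C"
    using Ml(1) Mr(1) by (auto simp: M_def T_def manipulations_def)
  have "winner (manipulate E M) l = winner (manipulate E Ml) l"
    using T Mr(2) disj abLR by (intro winner_cong) (auto simp: M_def manipulate_def)
  moreover have "winner (manipulate E M) r = winner (manipulate E Mr) r"
    using T Ml(2) disj abLR by (intro winner_cong) (auto simp: M_def manipulate_def)
  moreover have "(a, b) \<in> manipulate E M \<longleftrightarrow> w = a"
    using Ml(2) Mr(2) disj abLR w ne edge
    by (auto simp: M_def T_def manipulate_def)
  ultimately have "winner (manipulate E M) (Game l r) = w"
    using Ml(3) Mr(3) w by (auto simp: Let_def)
  moreover have "M \<subseteq> set (leaves (Game l r)) \<times> set (leaves (Game l r))"
    using Ml(2) Mr(2) T abLR by (auto simp: M_def)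
  ultimately show ?case using M by blast
qed

lemma constructively_manipulable_iff:
  assumes "tournament V E" "cup_over V c"
  shows "constructively_manipulable E c C w \<longleftrightarrow> w \<in> possible_winners E C c"
  using winner_possible[OF assms(1), of _ C c] possible_winner_wins[OF assms(1), of c w C] assms(2)
  by (auto simp: constructively_manipulable_def cup_over_def)

section \<open>Evaluation of a cup in postfix notation\<close>

text \<open>The possible winners of disjoint subcups are disjoint, so the evaluation stack of height \<open>d\<close>
  can be kept as one function: \<open>lev v\<close> is the position in the stack of the set containing \<open>v\<close>,
  or 0 if there is none. As no level exceeds \<open>d\<close>, levels with \<open>lev a + lev b + 1 = 2 * d\<close> are
  \<open>d - 1\<close> and \<open>d\<close> in some order, that is, \<open>a\<close> and \<open>b\<close> are on opposite sides of the game.\<close>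

definition meets_beatable :: "nat \<Rightarrow> nat rel \<Rightarrow> nat set \<Rightarrow> nat \<Rightarrow> (nat \<Rightarrow> nat) \<Rightarrow> nat \<Rightarrow> nat \<Rightarrow> bool" where
  "meets_beatable n E C d lev a b \<longleftrightarrow> b < n \<and> lev a + lev b + 1 = 2 * d \<and> may_beat E C a b"

text \<open>Levels below \<open>d - 1\<close> belong to deeper stack entries or to teams in no
  entry, which the game does not concern.\<close>

definition play :: "nat \<Rightarrow> nat rel \<Rightarrow> nat set \<Rightarrow> nat \<Rightarrow> (nat \<Rightarrow> nat) \<Rightarrow> nat \<Rightarrow> nat" where
  "play m E C d lev a =
     (if lev a < d - 1 then lev a else if \<exists>b. meets_beatable m E C d lev a b then d - 1 else 0)"

fun token :: "nat \<Rightarrow> nat rel \<Rightarrow> nat set \<Rightarrow> nat \<Rightarrow> nat \<times> (nat \<Rightarrow> nat) \<Rightarrow> nat \<times> (nat \<Rightarrow> nat)" where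
  "token m E C 0 (d, lev) = (d - 1, play m E C d lev)"
| "token m E C (Suc v) (d, lev) = (Suc d, lev(v := Suc d))"

text \<open>Evaluating a subcup pushes one entry onto an arbitrary stack. The assumption of level 0
  on the leaves survives until the right subcup, because the left one marks only its own
  leaves.\<close>

lemma fold_token_encode_cup:
  assumes "distinct (leaves c)" "set (leaves c) \<subseteq> {..<m}"
    and "\<And>v. v \<in> set (leaves c) \<Longrightarrow> lev v = 0" "\<And>v. lev v \<le> d"
  shows "fold (token m E C) (encode_cup c) (d, lev)
    = (Suc d, \<lambda>v. if v \<in> possible_winners E C c then Suc d else lev v)"
  using assms
proof (induction c arbitrary: d lev)
  case (Team v)
  then show ?case by (auto simp: fun_eq_iff)
next
  case (Game l r)
  let ?A = "possible_winners E C l" and ?B = "possible_winners E C r"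
  have AB: "?A \<subseteq> set (leaves l)" "?B \<subseteq> set (leaves r)"
    by (rule possible_winners_subset)+
  then have disj: "?A \<inter> ?B = {}" and lt: "?A \<subseteq> {..<m}" "?B \<subseteq> {..<m}"
    and zero: "\<And>v. v \<in> ?A \<union> ?B \<Longrightarrow> lev v = 0"
    using Game.prems by auto
  define lev1 where "lev1 = (\<lambda>v. if v \<in> ?A then Suc d else lev v)"
  define lev2 where "lev2 = (\<lambda>v. if v \<in> ?B then Suc (Suc d) else lev1 v)"
  have le1: "lev1 v \<le> Suc d" for v
    using Game.prems(4)[of v] by (simp add: lev1_def)
  have "fold (token m E C) (encode_cup l) (d, lev) = (Suc d, lev1)"
    unfolding lev1_def using Game.prems by (intro Game.IH(1)) auto
  moreover have "fold (token m E C) (encode_cup r) (Suc d, lev1) = (Suc (Suc d), lev2)"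
    unfolding lev2_def using Game.prems AB le1 by (intro Game.IH(2)) (auto simp: lev1_def)
  moreover have "play m E C (Suc (Suc d)) lev2 v
      = (if v \<in> possible_winners E C (Game l r) then Suc d else lev v)" for v
  proof -
    have lev2: "lev2 u = (if u \<in> ?B then Suc (Suc d) else if u \<in> ?A then Suc d else lev u)" for u
      by (simp add: lev2_def lev1_def)
    have le: "lev u \<le> d" for u by (rule Game.prems(4))
    consider "v \<in> ?A" "v \<notin> ?B" | "v \<in> ?B" "v \<notin> ?A" | "v \<notin> ?A" "v \<notin> ?B"
      using disj by auto
    then show ?thesis
    proof cases
      case 1
      \<comment> \<open>As \<open>v\<close> is at level \<open>Suc d\<close>, the equation forces
        \<open>b\<close> to level \<open>Suc (Suc d)\<close>, which only \<open>?B\<close>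
        has.\<close>
      have "lev2 v + lev2 b + 1 = 2 * Suc (Suc d) \<longleftrightarrow> b \<in> ?B" for b
        using 1 le[of b] by (auto simp: lev2)
      then show ?thesis
        using 1 zero lt by (auto simp: play_def meets_beatable_def lev2)
    next
      case 2
      have "lev2 v + lev2 b + 1 = 2 * Suc (Suc d) \<longleftrightarrow> b \<in> ?A" for b
        using 2 le[of b] disj by (auto simp: lev2)
      then show ?thesis
        using 2 zero lt by (auto simp: play_def meets_beatable_def lev2)
    next
      case 3
      \<comment> \<open>A team on neither side has level at most \<open>d\<close>, below the
        threshold \<open>Suc d\<close> in \<open>play\<close>.\<close>
      with le[of v] show ?thesis by (auto simp: play_def lev2)
    qed
  qed
  ultimately show ?case by (simp add: fun_eq_iff)
qed

section \<open>The program\<close>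

text \<open>Register 0 stays 0 until the answer is written, and register 4 holds the constant 1. The
  registers 2, 3, 5, 7 hold \<open>m\<close>, \<open>w\<close>, the number of unread tokens and the stack height. The
  adjacency matrix occupies the registers from 32 on, the coalition those from register 8 on, and
  the current levels those from register 6 on. Each game writes the new levels just above the
  old ones, so that no update disturbs the levels still to be compared.\<close>

definition compare_teams :: cmd where
  "compare_teams =
     Block [Load 19 15, Add 20 18 19, Add 20 20 4, Add 21 7 7, Sub 22 20 21, Sub 23 21 20,
            Add 20 22 23] ;;
     Unless 20 (Block [Load 24 11, Add 17 17 24, Load 24 16, Add 17 17 24]) ;;
     Block [Add 11 11 4, Add 15 15 4, Add 16 16 4, Sub 13 13 4]"

text \<open>The first value of register 22 is positive iff the team is outside the game, the second
  iff it found no beatable opponent. \<open>Add 18 21 0\<close> is a copy, as register 0 holds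
  0.\<close>

definition new_level :: cmd where
  "new_level =
     Block [Sub 21 7 4, Sub 22 21 18] ;;
     Unless 22
       (Block [Const 18 0, Sub 22 4 17] ;;
        Unless 22 (Block [Add 18 21 0])) ;;
     Block [Add 25 14 2, Store 25 18, Add 14 14 4, Sub 12 12 4]"

definition play_cmd :: cmd where
  "play_cmd =
     Block [Const 11 32, Add 14 6 0, Add 12 2 0] ;;
     Repeat
       (Block [Load 18 14, Add 15 6 0, Add 16 8 0, Add 13 2 0, Const 17 0] ;;
        Repeat compare_teams 13 ;;
        new_level) 12 ;;
     Block [Add 6 6 2, Sub 7 7 4]"

text \<open>\<open>Unless\<close> acts only on zero, so register 10 holds the negated token and the
  two tests form a case distinction. Subtracting 1 from the address undoes the shift of the leaf
  words.\<close>

definition token_cmd :: cmd where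
  "token_cmd =
     Block [Read 9, Sub 10 4 9, Sub 5 5 4] ;;
     Unless 9 play_cmd ;;
     Unless 10 (Block [Add 7 7 4, Add 20 6 9, Sub 20 20 4, Store 20 7])"

text \<open>For lack of multiplication, \<open>m\<close> is added \<open>m + 1\<close> times to get
  the size \<open>m * m + m\<close> of matrix and coalition. The base 32 lies above the scratch
  registers, which end at 25.\<close>

definition setup_cmd :: cmd where
  "setup_cmd =
     Block [Read 2, Read 3, Const 4 1, Add 12 2 4] ;;
     Repeat (Block [Add 25 25 2, Sub 12 12 4]) 12 ;;
     Block [Const 11 32] ;;
     Repeat (Block [Read 9, Store 11 9, Add 11 11 4, Sub 25 25 4]) 25 ;;
     Block [Sub 8 11 2, Add 6 11 0, Add 5 2 2, Sub 5 5 4]"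

text \<open>After the last token only levels 0 and 1 remain, so the level of \<open>w\<close> is
  itself the answer.\<close>

definition cup_cmd :: cmd where
  "cup_cmd = setup_cmd ;; Repeat token_cmd 5 ;; Block [Add 3 6 3, Load 0 3]"

section \<open>Memory invariants\<close>

lemma row_major_less:
  assumes "a < k" "b < (m :: nat)"
  shows "a * m + b < k * m"
proof -
  have "a * m + b < Suc a * m" using assms(2) by simp
  also have "\<dots> \<le> k * m" using assms(1) by (intro mult_le_mono) auto
  finally show ?thesis .
qed

definition holds_graph :: "nat \<Rightarrow> nat rel \<Rightarrow> nat set \<Rightarrow> (reg \<Rightarrow> nat) \<Rightarrow> bool" where
  "holds_graph m E C s \<longleftrightarrow> s 0 = 0 \<and> s 2 = m \<and> s 4 = 1 \<and> s 8 = 32 + m * m \<and>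
     (\<forall>i<m. \<forall>j<m. s (32 + i * m + j) = of_bool ((i, j) \<in> E)) \<and>
     (\<forall>j<m. s (32 + m * m + j) = of_bool (j \<in> C))"

definition holds_levels :: "nat \<Rightarrow> nat \<Rightarrow> (nat \<Rightarrow> nat) \<Rightarrow> (reg \<Rightarrow> nat) \<Rightarrow> bool" where
  "holds_levels m d lev s \<longleftrightarrow> s 7 = d \<and> 32 + m * m + m \<le> s 6 \<and> (\<forall>v<m. s (s 6 + v) = lev v)"

text \<open>The frame condition of the loops: registers 11 to 25 are scratch, and writing is allowed
  from \<open>l\<close> on.\<close>

definition agree_below :: "nat \<Rightarrow> (reg \<Rightarrow> nat) \<Rightarrow> (reg \<Rightarrow> nat) \<Rightarrow> bool" where
  "agree_below l s s' \<longleftrightarrow> (\<forall>x. x \<le> 10 \<or> 25 < x \<and> x < l \<longrightarrow> s' x = s x)"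

lemma holds_graph_agree:
  assumes "holds_graph m E C s" "agree_below l s s'" "32 + m * m + m \<le> l"
  shows "holds_graph m E C s'"
proof -
  have "32 + i * m + j < l" if "i < m" "j < m" for i j
    using row_major_less[OF that] assms(3) by linarith
  with assms show ?thesis by (simp add: holds_graph_def agree_below_def)
qed

lemma holds_graph_height: "holds_graph m E C (s(7 := d)) \<longleftrightarrow> holds_graph m E C s"
  by (simp add: holds_graph_def)

lemma holds_levels_agree:
  assumes "holds_levels m d lev s" "agree_below l s s'" "s 6 + m \<le> l"
  shows "holds_levels m d lev s'"
  using assms by (simp add: holds_levels_def agree_below_def)

section \<open>Correctness and time of a single game\<close>

lemma ensures_compare_teams:
  assumes inp: "holds_graph m E C s" and lev: "holds_levels m d lev s"
    and ab: "a < m" "b < m"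
    and s: "s 18 = lev a" "s 11 = 32 + a * m + b" "s 15 = s 6 + b" "s 16 = s 8 + b"
    and acc: "s 17 > 0 \<longleftrightarrow> (\<exists>b'<b. meets_beatable m E C d lev a b')"
  shows "ensures compare_teams (s, xs) 16 (\<lambda>(s', ys). ys = xs \<and>
     s' 11 = Suc (s 11) \<and> s' 15 = Suc (s 15) \<and> s' 16 = Suc (s 16) \<and> s' 13 = s 13 - 1 \<and>
     (s' 17 > 0 \<longleftrightarrow> (\<exists>b'<Suc b. meets_beatable m E C d lev a b')) \<and>
     (\<forall>x. x \<noteq> 11 \<and> x \<noteq> 13 \<and> x \<notin> {15..17} \<and> x \<notin> {19..24} \<longrightarrow> s' x = s x))"
proof -
  \<comment> \<open>The bounds \<open>big\<close> keep the array addresses clear of the scratch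
    registers written before the loads.\<close>
  have regs: "s 4 = 1" "s 7 = d" "s (s 6 + b) = lev b"
    "s (32 + a * m + b) = of_bool ((a, b) \<in> E)" "s (s 8 + b) = of_bool (b \<in> C)"
    and big: "s 8 \<ge> 32" "s 6 \<ge> 32"
    using inp lev ab by (auto simp: holds_graph_def holds_levels_def)
  define e where "e = (lev a + lev b + 1 - 2 * d) + (2 * d - (lev a + lev b + 1))"
  have e: "e = 0 \<longleftrightarrow> lev a + lev b + 1 = 2 * d"
    by (auto simp: e_def)
  define R where "R = (\<lambda>(s', ys :: nat list). ys = xs \<and> s' 20 = e \<and>
     (\<forall>x. x \<notin> {19..24} \<longrightarrow> s' x = s x))"
  define R' where "R' = (\<lambda>(s', ys :: nat list). ys = xs \<and>
     s' 17 = s 17 + (if e = 0 then of_bool ((a, b) \<in> E) + of_bool (b \<in> C) else 0) \<and>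
     (\<forall>x. x \<notin> {19..24} \<and> x \<noteq> 17 \<longrightarrow> s' x = s x))"
  have 1: "ensures (Block [Load 19 15, Add 20 18 19, Add 20 20 4, Add 21 7 7, Sub 22 20 21,
      Sub 23 21 20, Add 20 22 23]) (s, xs) 7 R"
    by (rule ensures_Block) (auto simp: effect_def R_def regs s e_def mult_2)
  have 2: "ensures (Unless 20 (Block [Load 24 11, Add 17 17 24, Load 24 16, Add 17 17 24]))
      \<tau> 5 R'" if "R \<tau>" for \<tau>
  proof -
    obtain s1 where \<tau>: "\<tau> = (s1, xs)" "s1 20 = e" "\<And>x. x \<notin> {19..24} \<Longrightarrow> s1 x = s x"
      using \<open>R \<tau>\<close> by (cases \<tau>) (auto simp: R_def)
    show ?thesis
      by (rule ensures_Unless[where t = 4], use \<tau> big in \<open>force simp: R'_def\<close>,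
        rule ensures_Block) (use \<tau> big regs s in \<open>auto simp: R'_def effect_def\<close>)
  qed
  have beats: "meets_beatable m E C d lev a b \<longleftrightarrow> e = 0 \<and> ((a, b) \<in> E \<or> b \<in> C)"
    using ab by (auto simp: meets_beatable_def may_beat_def e)
  have 3: "ensures (Block [Add 11 11 4, Add 15 15 4, Add 16 16 4, Sub 13 13 4]) \<tau> 4
     (\<lambda>(s', ys). ys = xs \<and>
     s' 11 = Suc (s 11) \<and> s' 15 = Suc (s 15) \<and> s' 16 = Suc (s 16) \<and> s' 13 = s 13 - 1 \<and>
     (s' 17 > 0 \<longleftrightarrow> (\<exists>b'<Suc b. meets_beatable m E C d lev a b')) \<and>
     (\<forall>x. x \<noteq> 11 \<and> x \<noteq> 13 \<and> x \<notin> {15..17} \<and> x \<notin> {19..24} \<longrightarrow> s' x = s x))"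
    if "R' \<tau>" for \<tau>
  proof -
    obtain s1 where \<tau>: "\<tau> = (s1, xs)"
      "s1 17 = s 17 + (if e = 0 then of_bool ((a, b) \<in> E) + of_bool (b \<in> C) else 0)"
      "\<And>x. x \<notin> {19..24} \<Longrightarrow> x \<noteq> 17 \<Longrightarrow> s1 x = s x"
      using \<open>R' \<tau>\<close> by (cases \<tau>) (auto simp: R'_def)
    have "s1 17 > 0 \<longleftrightarrow> (\<exists>b'<Suc b. meets_beatable m E C d lev a b')"
      using acc unfolding less_Suc_eq \<tau>(2) by (auto simp: beats)
    then show ?thesis
      by (intro ensures_Block) (use \<tau>(1,3) regs in \<open>auto simp: effect_def\<close>)
  qed
  show ?thesis
    unfolding compare_teams_def
    by (rule ensures_Seq[OF 1 ensures_Seq[OF 2 3 order_refl]]) simp_all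
qed

lemma ensures_new_level:
  assumes s: "s 0 = 0" "s 2 = m" "s 4 = 1" "s 14 > 25"
  shows "ensures new_level (s, xs) 11 (\<lambda>(s', ys). ys = xs \<and>
     s' (s 14 + m) = (if s 18 < s 7 - 1 then s 18 else if s 17 > 0 then s 7 - 1 else 0) \<and>
     s' 14 = Suc (s 14) \<and> s' 12 = s 12 - 1 \<and>
     (\<forall>x. x \<notin> {12, 14, 18, 21, 22, 25, s 14 + m} \<longrightarrow> s' x = s x))"
proof -
  define v where "v = (if s 18 < s 7 - 1 then s 18 else if s 17 > 0 then s 7 - 1 else 0)"
  define R where "R = (\<lambda>(s', ys :: nat list). ys = xs \<and> s' 21 = s 7 - 1 \<and>
     s' 22 = s 7 - 1 - s 18 \<and> (\<forall>x. x \<notin> {21, 22} \<longrightarrow> s' x = s x))"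
  define R' where "R' = (\<lambda>(s', ys :: nat list). ys = xs \<and> s' 18 = v \<and>
     (\<forall>x. x \<notin> {18, 21, 22} \<longrightarrow> s' x = s x))"
  have 1: "ensures (Block [Sub 21 7 4, Sub 22 21 18]) (s, xs) 2 R"
    by (rule ensures_Block) (auto simp: effect_def R_def s)
  have 2: "ensures (Unless 22
       (Block [Const 18 0, Sub 22 4 17] ;; Unless 22 (Block [Add 18 21 0]))) \<tau> 5 R'"
    if "R \<tau>" for \<tau>
  proof -
    obtain s1 where \<tau>: "\<tau> = (s1, xs)" "s1 21 = s 7 - 1" "s1 22 = s 7 - 1 - s 18"
      "\<And>x. x \<notin> {21, 22} \<Longrightarrow> s1 x = s x"
      using \<open>R \<tau>\<close> by (cases \<tau>) (auto simp: R_def)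
    define S where "S = (\<lambda>(s', ys :: nat list). ys = xs \<and> s' 18 = 0 \<and> s' 21 = s 7 - 1 \<and>
       s' 22 = 1 - s 17 \<and> (\<forall>x. x \<notin> {18, 21, 22} \<longrightarrow> s' x = s x))"
    have A: "ensures (Block [Const 18 0, Sub 22 4 17]) \<tau> 2 S"
      by (rule ensures_Block) (use \<tau> s in \<open>auto simp: effect_def S_def\<close>)
    have B: "ensures (Unless 22 (Block [Add 18 21 0])) \<upsilon> 2 R'"
      if "S \<upsilon>" "s1 22 = 0" for \<upsilon>
    proof -
      obtain s2 where \<upsilon>: "\<upsilon> = (s2, xs)" "s2 18 = 0" "s2 21 = s 7 - 1" "s2 22 = 1 - s 17"
        "\<And>x. x \<notin> {18, 21, 22} \<Longrightarrow> s2 x = s x"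
        using \<open>S \<upsilon>\<close> by (cases \<upsilon>) (auto simp: S_def)
      show ?thesis
        by (rule ensures_Unless[where t = 1], use \<upsilon> \<tau> that in \<open>simp add: R'_def v_def\<close>,
          rule ensures_Block) (use \<upsilon> \<tau> that s in \<open>auto simp: R'_def v_def effect_def\<close>)
    qed
    show ?thesis
    proof (rule ensures_Unless)
      show "R' \<tau>" if "fst \<tau> 22 > 0"
        using \<tau> that by (auto simp: R'_def v_def)
      show "ensures (Block [Const 18 0, Sub 22 4 17] ;; Unless 22 (Block [Add 18 21 0])) \<tau> 4 R'"
        if "fst \<tau> 22 = 0"
        by (rule ensures_Seq[OF A B]) (use \<tau>(1) that in auto)
    qed simp
  qed
  have 3: "ensures (Block [Add 25 14 2, Store 25 18, Add 14 14 4, Sub 12 12 4]) \<tau> 4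
     (\<lambda>(s', ys). ys = xs \<and> s' (s 14 + m) = v \<and> s' 14 = Suc (s 14) \<and> s' 12 = s 12 - 1 \<and>
     (\<forall>x. x \<notin> {12, 14, 18, 21, 22, 25, s 14 + m} \<longrightarrow> s' x = s x))"
    if "R' \<tau>" for \<tau>
  proof -
    obtain s1 where \<tau>: "\<tau> = (s1, xs)" "s1 18 = v" "\<And>x. x \<notin> {18, 21, 22} \<Longrightarrow> s1 x = s x"
      using \<open>R' \<tau>\<close> by (cases \<tau>) (auto simp: R'_def)
    show ?thesis
      by (rule ensures_Block) (use \<tau> s in \<open>auto simp: effect_def\<close>)
  qed
  show ?thesis
    unfolding new_level_def v_def[symmetric]
    by (rule ensures_Seq[OF 1 ensures_Seq[OF 2 3 order_refl]]) simp_all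
qed

lemma ensures_play_step:
  assumes inp: "holds_graph m E C s" and lev: "holds_levels m d lev s"
    and s: "a < m" "s 14 = s 6 + a" "s 11 = 32 + a * m"
  shows "ensures
     (Block [Load 18 14, Add 15 6 0, Add 16 8 0, Add 13 2 0, Const 17 0] ;;
      Repeat compare_teams 13 ;; new_level) (s, xs) (17 * m + 16)
     (\<lambda>(s', ys). ys = xs \<and> s' (s 6 + m + a) = play m E C d lev a \<and>
       s' 14 = Suc (s 14) \<and> s' 11 = s 11 + m \<and> s' 12 = s 12 - 1 \<and>
       (\<forall>x. x \<notin> {11..25} \<and> x \<noteq> s 6 + m + a \<longrightarrow> s' x = s x))"
proof -
  have regs: "s 0 = 0" "s 2 = m" "s 4 = 1" "s 8 = 32 + m * m" "s 7 = d" "s (s 6 + a) = lev a"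
    and big: "32 + m * m + m \<le> s 6"
    using inp lev s by (auto simp: holds_graph_def holds_levels_def)
  define K where "K b = (\<lambda>(s', ys :: nat list). ys = xs \<and> s' 18 = lev a \<and>
     s' 11 = 32 + a * m + b \<and> s' 15 = s 6 + b \<and> s' 16 = s 8 + b \<and> s' 13 = m - b \<and>
     (s' 17 > 0 \<longleftrightarrow> (\<exists>b'<b. meets_beatable m E C d lev a b')) \<and>
     (\<forall>x. x \<le> 10 \<or> x = 12 \<or> x = 14 \<or> 24 < x \<longrightarrow> s' x = s x))" for b
  \<comment> \<open>\<open>ensures_Repeat\<close> counts the iterations left, \<open>K\<close> the
    opponents already compared; \<open>b + k = m\<close> links the two.\<close>
  define J where "J k \<tau> \<longleftrightarrow> (\<exists>b. b + k = m \<and> K b \<tau>)" for k \<tau>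
  have 1: "ensures (Block [Load 18 14, Add 15 6 0, Add 16 8 0, Add 13 2 0, Const 17 0])
      (s, xs) 5 (J m)"
    by (rule ensures_Block) (use s regs in \<open>auto simp: effect_def J_def K_def\<close>)
  have step: "ensures compare_teams \<tau> 16 (\<lambda>\<upsilon>. J k \<upsilon> \<and> fst \<upsilon> 13 = k)" if "J (Suc k) \<tau>" for k \<tau>
  proof -
    from that obtain b where b: "b + Suc k = m" and "K b \<tau>"
      unfolding J_def by blast
    then obtain s1 where \<tau>: "\<tau> = (s1, xs)" and "K b (s1, xs)"
      by (cases \<tau>) (simp add: K_def)
    then have s1: "s1 18 = lev a" "s1 11 = 32 + a * m + b" "s1 15 = s 6 + b" "s1 16 = s 8 + b"
      "s1 13 = Suc k" "s1 17 > 0 \<longleftrightarrow> (\<exists>b'<b. meets_beatable m E C d lev a b')"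
      and same: "\<And>x. x \<le> 10 \<or> x = 12 \<or> x = 14 \<or> 24 < x \<Longrightarrow> s1 x = s x"
      using b by (auto simp: K_def)
    have agree: "agree_below (s 6 + m) s s1"
      using same by (auto simp: agree_below_def)
    have "ensures compare_teams (s1, xs) 16 (\<lambda>(s', ys). ys = xs \<and>
       s' 11 = Suc (s1 11) \<and> s' 15 = Suc (s1 15) \<and> s' 16 = Suc (s1 16) \<and> s' 13 = s1 13 - 1 \<and>
       (s' 17 > 0 \<longleftrightarrow> (\<exists>b'<Suc b. meets_beatable m E C d lev a b')) \<and>
       (\<forall>x. x \<noteq> 11 \<and> x \<noteq> 13 \<and> x \<notin> {15..17} \<and> x \<notin> {19..24} \<longrightarrow> s' x = s1 x))"
      using b s s1 same big
      by (intro ensures_compare_teams[OF holds_graph_agree[OF inp agree]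
        holds_levels_agree[OF lev agree]]) auto
    then show ?thesis
      unfolding \<tau>
    proof (rule ensures_weaken)
      fix \<upsilon> :: state
      assume "case \<upsilon> of (s', ys) \<Rightarrow> ys = xs \<and>
       s' 11 = Suc (s1 11) \<and> s' 15 = Suc (s1 15) \<and> s' 16 = Suc (s1 16) \<and> s' 13 = s1 13 - 1 \<and>
       (s' 17 > 0 \<longleftrightarrow> (\<exists>b'<Suc b. meets_beatable m E C d lev a b')) \<and>
       (\<forall>x. x \<noteq> 11 \<and> x \<noteq> 13 \<and> x \<notin> {15..17} \<and> x \<notin> {19..24} \<longrightarrow> s' x = s1 x)"
      then have "K (Suc b) \<upsilon>" "fst \<upsilon> 13 = k"
        using b s1 same by (simp_all add: K_def split_beta)
      then show "J k \<upsilon> \<and> fst \<upsilon> 13 = k"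
        using b by (auto simp: J_def)
    qed simp
  qed
  \<comment> \<open>The body of \<open>Repeat\<close> is executed at least once, so \<open>m\<close>
    has to be positive.\<close>
  obtain m' where m': "m = Suc m'"
    using s(1) by (cases m) auto
  have 2: "ensures (Repeat compare_teams 13) \<tau> (17 * m) (J 0)" if "J m \<tau>" for \<tau>
    by (rule ensures_Repeat[where I = J and n = m', OF step]) (use that m' in auto)
  have 3: "ensures new_level \<tau> 11
     (\<lambda>(s', ys). ys = xs \<and> s' (s 6 + m + a) = play m E C d lev a \<and>
       s' 14 = Suc (s 14) \<and> s' 11 = s 11 + m \<and> s' 12 = s 12 - 1 \<and>
       (\<forall>x. x \<notin> {11..25} \<and> x \<noteq> s 6 + m + a \<longrightarrow> s' x = s x))" if "J 0 \<tau>" for \<tau>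
  proof -
    from that have "K m \<tau>"
      by (simp add: J_def)
    then obtain s1 where \<tau>: "\<tau> = (s1, xs)" and "K m (s1, xs)"
      by (cases \<tau>) (simp add: K_def)
    then have s1: "s1 18 = lev a" "s1 11 = 32 + a * m + m"
      "s1 17 > 0 \<longleftrightarrow> (\<exists>b'<m. meets_beatable m E C d lev a b')"
      and same: "\<And>x. x \<le> 10 \<or> x = 12 \<or> x = 14 \<or> 24 < x \<Longrightarrow> s1 x = s x"
      by (auto simp: K_def)
    have "s1 17 > 0 \<longleftrightarrow> (\<exists>b'. meets_beatable m E C d lev a b')"
      unfolding s1(3) by (auto simp: meets_beatable_def)
    then have new: "play m E C d lev a
        = (if s1 18 < s1 7 - 1 then s1 18 else if s1 17 > 0 then s1 7 - 1 else 0)"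
      using s1(1) same regs(5) by (auto simp: play_def)
    have "ensures new_level (s1, xs) 11 (\<lambda>(s', ys). ys = xs \<and>
       s' (s1 14 + m) = (if s1 18 < s1 7 - 1 then s1 18 else if s1 17 > 0 then s1 7 - 1 else 0) \<and>
       s' 14 = Suc (s1 14) \<and> s' 12 = s1 12 - 1 \<and>
       (\<forall>x. x \<notin> {12, 14, 18, 21, 22, 25, s1 14 + m} \<longrightarrow> s' x = s1 x))"
      using same regs big s by (intro ensures_new_level) auto
    then show ?thesis
      unfolding \<tau> new[symmetric]
      by (rule ensures_weaken) (use same s s1 big in \<open>auto simp: add_ac\<close>)
  qed
  show ?thesis
    by (rule ensures_Seq[OF 1 ensures_Seq[OF 2 3 order_refl]]) simp_all
qed

lemma ensures_play_cmd:
  assumes inp: "holds_graph m E C s" and lev: "holds_levels m d lev s" and m: "m > 0"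
  shows "ensures play_cmd (s, xs) (m * (17 * m + 17) + 5)
     (\<lambda>(s', ys). ys = xs \<and> holds_graph m E C s' \<and> holds_levels m (d - 1) (play m E C d lev) s' \<and>
       s' 3 = s 3 \<and> s' 5 = s 5 \<and> s' 10 = s 10)"
proof -
  have regs: "s 0 = 0" "s 2 = m" "s 4 = 1" "s 7 = d" and big: "32 + m * m + m \<le> s 6"
    using inp lev by (auto simp: holds_graph_def holds_levels_def)
  define K where "K a = (\<lambda>(s', ys :: nat list). ys = xs \<and> s' 14 = s 6 + a \<and> s' 11 = 32 + a * m \<and>
     s' 12 = m - a \<and> (\<forall>v<a. s' (s 6 + m + v) = play m E C d lev v) \<and>
     agree_below (s 6 + m) s s')" for a
  define J where "J k \<tau> \<longleftrightarrow> (\<exists>a. a + k = m \<and> K a \<tau>)" for k \<tau>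
  let ?body = "Block [Load 18 14, Add 15 6 0, Add 16 8 0, Add 13 2 0, Const 17 0] ;;
      Repeat compare_teams 13 ;; new_level"
  have 1: "ensures (Block [Const 11 32, Add 14 6 0, Add 12 2 0]) (s, xs) 3 (J m)"
    by (rule ensures_Block) (use regs in \<open>auto simp: effect_def J_def K_def agree_below_def\<close>)
  have step: "ensures ?body \<tau> (17 * m + 16) (\<lambda>\<upsilon>. J k \<upsilon> \<and> fst \<upsilon> 12 = k)" if "J (Suc k) \<tau>" for k \<tau>
  proof -
    from that obtain a where a: "a + Suc k = m" and "K a \<tau>"
      unfolding J_def by blast
    then obtain s1 where \<tau>: "\<tau> = (s1, xs)" and "K a (s1, xs)"
      by (cases \<tau>) (simp add: K_def)
    then have s1: "s1 14 = s 6 + a" "s1 11 = 32 + a * m" "s1 12 = m - a"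
      and new: "\<And>v. v < a \<Longrightarrow> s1 (s 6 + m + v) = play m E C d lev v"
      and agree: "agree_below (s 6 + m) s s1"
      by (auto simp: K_def)
    have s16: "s1 6 = s 6"
      using agree by (simp add: agree_below_def)
    have "ensures ?body (s1, xs) (17 * m + 16)
      (\<lambda>(s', ys). ys = xs \<and> s' (s1 6 + m + a) = play m E C d lev a \<and>
       s' 14 = Suc (s1 14) \<and> s' 11 = s1 11 + m \<and> s' 12 = s1 12 - 1 \<and>
       (\<forall>x. x \<notin> {11..25} \<and> x \<noteq> s1 6 + m + a \<longrightarrow> s' x = s1 x))"
      using a s1 s16 big
      by (intro ensures_play_step holds_graph_agree[OF inp agree] holds_levels_agree[OF lev agree])
        auto
    then show ?thesis
      unfolding \<tau>
    proof (rule ensures_weaken)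
      fix \<upsilon> :: state
      assume "case \<upsilon> of (s', ys) \<Rightarrow> ys = xs \<and> s' (s1 6 + m + a) = play m E C d lev a \<and>
       s' 14 = Suc (s1 14) \<and> s' 11 = s1 11 + m \<and> s' 12 = s1 12 - 1 \<and>
       (\<forall>x. x \<notin> {11..25} \<and> x \<noteq> s1 6 + m + a \<longrightarrow> s' x = s1 x)"
      then obtain s2 where \<upsilon>: "\<upsilon> = (s2, xs)"
        and s2: "s2 (s 6 + m + a) = play m E C d lev a"
          "s2 14 = Suc (s1 14)" "s2 11 = s1 11 + m" "s2 12 = s1 12 - 1"
        and same: "\<And>x. x \<notin> {11..25} \<Longrightarrow> x \<noteq> s 6 + m + a \<Longrightarrow> s2 x = s1 x"
        unfolding s16 by (cases \<upsilon>) auto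
      have "s2 (s 6 + m + v) = play m E C d lev v" if "v < Suc a" for v
        using that s2(1) same[of "s 6 + m + v"] new[of v] big by (cases "v = a") auto
      moreover have "agree_below (s 6 + m) s s2"
        using agree same big by (auto simp: agree_below_def)
      ultimately have "K (Suc a) \<upsilon>"
        using s1 s2 by (simp add: K_def \<upsilon>)
      moreover have "fst \<upsilon> 12 = k"
        using s1 s2 a by (simp add: \<upsilon>)
      ultimately show "J k \<upsilon> \<and> fst \<upsilon> 12 = k"
        using a by (auto simp: J_def)
    qed simp
  qed
  obtain m' where m': "m = Suc m'"
    using m by (cases m) auto
  have 2: "ensures (Repeat ?body 12) \<tau> (m * (17 * m + 17)) (J 0)" if "J m \<tau>" for \<tau>
    by (rule ensures_Repeat[where I = J and n = m', OF step]) (use that m' in auto)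
  have 3: "ensures (Block [Add 6 6 2, Sub 7 7 4]) \<tau> 2
     (\<lambda>(s', ys). ys = xs \<and> holds_graph m E C s' \<and> holds_levels m (d - 1) (play m E C d lev) s' \<and>
       s' 3 = s 3 \<and> s' 5 = s 5 \<and> s' 10 = s 10)" if "J 0 \<tau>" for \<tau>
  proof -
    from that have "K m \<tau>"
      by (simp add: J_def)
    then obtain s1 where \<tau>: "\<tau> = (s1, xs)" and "K m (s1, xs)"
      by (cases \<tau>) (simp add: K_def)
    then have new: "\<And>v. v < m \<Longrightarrow> s1 (s 6 + m + v) = play m E C d lev v"
      and agree: "agree_below (s 6 + m) s s1"
      by (auto simp: K_def)
    have low: "s1 x = s x" if "x \<le> 10" for x
      using agree that by (simp add: agree_below_def)
    \<comment> \<open>Moving the base by \<open>m\<close> makes the freshly written array the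
      current one.\<close>
    let ?s' = "s1(6 := s 6 + m, 7 := d - 1)"
    have "holds_graph m E C s1"
      by (rule holds_graph_agree[OF inp agree]) (use big in simp)
    then have "holds_graph m E C ?s'"
      by (simp add: holds_graph_def)
    moreover have "holds_levels m (d - 1) (play m E C d lev) ?s'"
      using big new by (simp add: holds_levels_def)
    ultimately show ?thesis
      by (intro ensures_Block) (use low regs in \<open>simp_all add: effect_def \<tau>\<close>)
  qed
  show ?thesis
    unfolding play_cmd_def
    by (rule ensures_Seq[OF 1 ensures_Seq[OF 2 3 order_refl]]) simp_all
qed

section \<open>The loop over the tokens\<close>

lemma ensures_token_cmd:
  assumes inp: "holds_graph m E C s" and lev: "holds_levels m d lev s" and m: "m > 0"
    and tok: "k \<le> m" and token: "token m E C k (d, lev) = (d', lev')"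
  shows "ensures token_cmd (s, k # xs) (m * (17 * m + 17) + 14)
     (\<lambda>(s', ys). ys = xs \<and> holds_graph m E C s' \<and> holds_levels m d' lev' s' \<and>
       s' 3 = s 3 \<and> s' 5 = s 5 - 1)"
proof -
  have regs: "s 0 = 0" "s 2 = m" "s 4 = 1" "s 7 = d" and big: "32 + m * m + m \<le> s 6"
    using inp lev by (auto simp: holds_graph_def holds_levels_def)
  define s1 where "s1 = s(9 := k, 10 := 1 - k, 5 := s 5 - 1)"
  have inp1: "holds_graph m E C s1" and lev1: "holds_levels m d lev s1"
    using inp lev by (simp_all add: holds_graph_def holds_levels_def s1_def)
  let ?Q = "\<lambda>(s', ys). ys = xs \<and> holds_graph m E C s' \<and> holds_levels m d' lev' s' \<and>
       s' 3 = s 3 \<and> s' 5 = s 5 - 1"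
  have 1: "ensures (Block [Read 9, Sub 10 4 9, Sub 5 5 4]) (s, k # xs) 3 (\<lambda>\<tau>. \<tau> = (s1, xs))"
    by (rule ensures_Block) (use regs in \<open>simp_all add: effect_def s1_def\<close>)
  show ?thesis
  proof (cases k)
    case 0
    define R where "R = (\<lambda>(s', ys). ys = xs \<and> holds_graph m E C s' \<and>
       holds_levels m (d - 1) (play m E C d lev) s' \<and> s' 3 = s1 3 \<and> s' 5 = s1 5 \<and> s' 10 = s1 10)"
    have "ensures (Unless 9 play_cmd) (s1, xs) (m * (17 * m + 17) + 6) R"
      by (rule ensures_Unless[where t = "m * (17 * m + 17) + 5"], use 0 in \<open>simp add: s1_def\<close>)
        (use ensures_play_cmd[OF inp1 lev1 m, of xs] in \<open>simp_all add: R_def\<close>)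
    then have 2: "ensures (Unless 9 play_cmd) \<tau> (m * (17 * m + 17) + 6) R" if "\<tau> = (s1, xs)" for \<tau>
      using that by simp
    \<comment> \<open>For token 0 register 10 is 1 and \<open>play_cmd\<close> preserves it, so the
      leaf branch is skipped.\<close>
    have 3: "ensures (Unless 10 (Block [Add 7 7 4, Add 20 6 9, Sub 20 20 4, Store 20 7])) \<tau> 5 ?Q"
      if "R \<tau>" for \<tau>
      by (rule ensures_Unless[where t = 4]) (use that 0 token in \<open>auto simp: R_def s1_def\<close>)
    show ?thesis
      unfolding token_cmd_def
      by (rule ensures_Seq[OF 1 ensures_Seq[OF 2 3 order_refl]]) simp_all
  next
    case (Suc v)
    have 2: "ensures (Unless 9 play_cmd) \<tau> (m * (17 * m + 17) + 6) (\<lambda>\<tau>. \<tau> = (s1, xs))"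
      if "\<tau> = (s1, xs)" for \<tau>
    proof -
      have "runs (Unless 9 play_cmd) (s1, xs) 1 (s1, xs)"
        by (rule runs.Unless_skip) (simp add: s1_def Suc)
      then show ?thesis unfolding ensures_def that
        by (intro exI[of _ 1] exI[of _ "(s1, xs)"]) simp
    qed
    let ?s2 = "s1(7 := Suc d, 20 := s 6 + v, s 6 + v := Suc d)"
    have d': "d' = Suc d" "lev' = lev(v := Suc d)" and v: "v < m"
      using token tok Suc by auto
    \<comment> \<open>The frame condition includes register 7, so the new height is undone here and
      restored by \<open>holds_graph_height\<close>.\<close>
    have "agree_below (s 6) s1 (?s2(7 := d))"
      using lev1 big by (auto simp: agree_below_def holds_levels_def)
    then have "holds_graph m E C (?s2(7 := d))"
      by (rule holds_graph_agree[OF inp1]) (use big in simp)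
    then have inp2: "holds_graph m E C ?s2"
      by (simp only: holds_graph_height)
    have lev2: "holds_levels m d' lev' ?s2"
      using lev1 big v d' by (simp add: holds_levels_def s1_def)
    have 3: "ensures (Unless 10 (Block [Add 7 7 4, Add 20 6 9, Sub 20 20 4, Store 20 7])) \<tau> 5 ?Q"
      if "\<tau> = (s1, xs)" for \<tau>
    proof (rule ensures_Unless)
      have "s1 4 = 1" "s1 7 = d" "s1 6 = s 6" "s1 9 = Suc v" "s1 3 = s 3" "s1 5 = s 5 - 1"
        using regs by (simp_all add: s1_def Suc)
      then show "ensures (Block [Add 7 7 4, Add 20 6 9, Sub 20 20 4, Store 20 7]) \<tau> 4 ?Q"
        by (intro ensures_Block) (use that big inp2 lev2 in \<open>simp_all add: effect_def\<close>)
      show "?Q \<tau>" if "fst \<tau> 10 > 0"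
        using that \<open>\<tau> = (s1, xs)\<close> by (simp add: s1_def Suc)
    qed simp
    show ?thesis
      unfolding token_cmd_def
      by (rule ensures_Seq[OF 1 ensures_Seq[OF 2 3 order_refl]]) simp_all
  qed
qed

lemma ensures_tokens:
  assumes "holds_graph m E C s" "holds_levels m d lev s" "m > 0"
    and "ts \<noteq> []" "set ts \<subseteq> {..m}" "s 5 = length ts"
  shows "ensures (Repeat token_cmd 5) (s, ts) (length ts * (m * (17 * m + 17) + 15))
     (\<lambda>(s', ys). holds_graph m E C s' \<and> s' 3 = s 3 \<and>
       (case fold (token m E C) ts (d, lev) of (d', lev') \<Rightarrow> holds_levels m d' lev' s'))"
proof -
  \<comment> \<open>Folding the unread tokens over the current stack always yields the same final
    stack.\<close>
  define I where "I k = (\<lambda>(s', ys :: nat list). length ys = k \<and> set ys \<subseteq> {..m} \<and> s' 5 = k \<and>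
     s' 3 = s 3 \<and> holds_graph m E C s' \<and> (\<exists>d' lev'. holds_levels m d' lev' s' \<and>
       fold (token m E C) ys (d', lev') = fold (token m E C) ts (d, lev)))" for k
  have step: "ensures token_cmd \<tau> (m * (17 * m + 17) + 14) (\<lambda>\<upsilon>. I k \<upsilon> \<and> fst \<upsilon> 5 = k)"
    if "I (Suc k) \<tau>" for k \<tau>
  proof -
    obtain s1 ys where \<tau>: "\<tau> = (s1, ys)"
      by (cases \<tau>)
    with that obtain d1 lev1 where s1: "length ys = Suc k" "set ys \<subseteq> {..m}" "s1 5 = Suc k"
      "s1 3 = s 3" "holds_graph m E C s1" "holds_levels m d1 lev1 s1"
      "fold (token m E C) ys (d1, lev1) = fold (token m E C) ts (d, lev)"
      unfolding I_def by auto
    then obtain t zs where ys: "ys = t # zs"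
      by (cases ys) auto
    obtain d2 lev2 where tok: "token m E C t (d1, lev1) = (d2, lev2)"
      by (cases "token m E C t (d1, lev1)")
    have "t \<le> m" using s1(2) ys by simp
    show ?thesis
      unfolding \<tau> ys
      by (rule ensures_weaken[OF ensures_token_cmd[OF s1(5,6) assms(3) \<open>t \<le> m\<close> tok]])
        (use s1 ys tok in \<open>auto simp: I_def\<close>)
  qed
  obtain n where n: "length ts = Suc n"
    using assms(4) by (cases ts) auto
  show ?thesis
  proof (rule ensures_Repeat[where I = I and n = n, OF step])
    show "I (Suc n) (s, ts)"
      using assms n by (auto simp: I_def)
  qed (use n in \<open>auto simp: I_def\<close>)
qed

section \<open>Reading the input\<close>

lemma ensures_setup_cmd:
  assumes m: "m > 0" and data: "length data = m * m + m"
  shows "ensures setup_cmd (\<lambda>_. 0, m # w # data @ rest) (5 * m * m + 8 * m + 12)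
     (\<lambda>(s, ys). ys = rest \<and> s 0 = 0 \<and> s 2 = m \<and> s 3 = w \<and> s 4 = 1 \<and> s 5 = 2 * m - 1 \<and>
       s 6 = 32 + m * m + m \<and> s 7 = 0 \<and> s 8 = 32 + m * m \<and>
       (\<forall>i<m * m + m. s (32 + i) = data ! i) \<and> (\<forall>x\<ge>32 + m * m + m. s x = 0))"
proof -
  define start where "start = ((\<lambda>_. 0)(2 := m, 3 := w, 4 := 1) :: reg \<Rightarrow> nat)"
  define I where "I k \<tau> \<longleftrightarrow> (\<exists>i. i + k = Suc m \<and>
     \<tau> = (start(25 := i * m, 12 := k), data @ rest))" for k and \<tau> :: state
  have 1: "ensures (Block [Read 2, Read 3, Const 4 1, Add 12 2 4])
      (\<lambda>_. 0, m # w # data @ rest) 4 (I (Suc m))"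
    by (rule ensures_Block) (auto simp: effect_def I_def start_def)
  have step: "ensures (Block [Add 25 25 2, Sub 12 12 4]) \<tau> 2 (\<lambda>\<upsilon>. I k \<upsilon> \<and> fst \<upsilon> 12 = k)"
    if "I (Suc k) \<tau>" for k \<tau>
  proof -
    from that obtain i where i: "i + Suc k = Suc m"
      and \<tau>: "\<tau> = (start(25 := i * m, 12 := Suc k), data @ rest)"
      unfolding I_def by blast
    have "fold effect [Add 25 25 2, Sub 12 12 4] \<tau> = (start(25 := Suc i * m, 12 := k), data @ rest)"
      by (auto simp: effect_def start_def \<tau> fun_eq_iff)
    then show ?thesis
      using i by (intro ensures_Block) (auto simp: I_def intro!: exI[of _ "Suc i"])
  qed
  have 2: "ensures (Repeat (Block [Add 25 25 2, Sub 12 12 4]) 12) \<tau> (3 * m + 3) (I 0)"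
    if "I (Suc m) \<tau>" for \<tau>
    by (rule ensures_Repeat[where I = I and n = m, OF step]) (use that in auto)
  \<comment> \<open>The registers beyond the copied words are still 0; they later serve as the
    levels of the empty stack.\<close>
  define K where "K n = (\<lambda>(s, ys). ys = drop n data @ rest \<and> s 11 = 32 + n \<and>
     s 25 = m * m + m - n \<and> (\<forall>x<9. s x = start x) \<and>
     (\<forall>i<n. s (32 + i) = data ! i) \<and> (\<forall>x\<ge>32 + n. s x = 0))" for n
  define J where "J k \<tau> \<longleftrightarrow> (\<exists>n. n + k = m * m + m \<and> K n \<tau>)" for k \<tau>
  have 3: "ensures (Block [Const 11 32]) \<tau> 1 (J (m * m + m))" if "I 0 \<tau>" for \<tau>
    by (rule ensures_Block) (use that in \<open>auto simp: effect_def start_def I_def J_def K_def\<close>)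
  have copy: "ensures (Block [Read 9, Store 11 9, Add 11 11 4, Sub 25 25 4]) \<tau> 4
      (\<lambda>\<upsilon>. J k \<upsilon> \<and> fst \<upsilon> 25 = k)" if "J (Suc k) \<tau>" for k \<tau>
  proof -
    from that obtain n where n: "n + Suc k = m * m + m" and "K n \<tau>"
      unfolding J_def by blast
    then obtain s where \<tau>: "\<tau> = (s, drop n data @ rest)" and s: "s 11 = 32 + n"
      "s 25 = m * m + m - n" and low: "\<And>x. x < 9 \<Longrightarrow> s x = start x"
      and arr: "\<And>i. i < n \<Longrightarrow> s (32 + i) = data ! i" "\<And>x. x \<ge> 32 + n \<Longrightarrow> s x = 0"
      by (cases \<tau>) (auto simp: K_def)
    have s4: "s 4 = 1"
      using low by (simp add: start_def)
    have drop: "drop n data = data ! n # drop (Suc n) data"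
      using n data by (simp add: Cons_nth_drop_Suc)
    let ?s' = "s(9 := data ! n, 32 + n := data ! n, 11 := 32 + Suc n, 25 := k)"
    have "fold effect [Read 9, Store 11 9, Add 11 11 4, Sub 25 25 4] \<tau>
        = (?s', drop (Suc n) data @ rest)"
      using n s s4 by (auto simp: effect_def \<tau> drop fun_eq_iff)
    moreover have "K (Suc n) (?s', drop (Suc n) data @ rest)"
      using n low arr by (auto simp: K_def less_Suc_eq)
    then have "J k (?s', drop (Suc n) data @ rest)"
      using n unfolding J_def by (intro exI[of _ "Suc n"]) simp
    ultimately show ?thesis
      by (intro ensures_Block) simp_all
  qed
  obtain l where l: "m * m + m = Suc l"
    using m by (cases "m * m + m") auto
  have 4: "ensures (Repeat (Block [Read 9, Store 11 9, Add 11 11 4, Sub 25 25 4]) 25) \<tau>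
      (5 * (m * m + m)) (J 0)" if "J (m * m + m) \<tau>" for \<tau>
    by (rule ensures_Repeat[where I = J and n = l, OF copy]) (use that l in auto)
  have 5: "ensures (Block [Sub 8 11 2, Add 6 11 0, Add 5 2 2, Sub 5 5 4]) \<tau> 4
     (\<lambda>(s, ys). ys = rest \<and> s 0 = 0 \<and> s 2 = m \<and> s 3 = w \<and> s 4 = 1 \<and> s 5 = 2 * m - 1 \<and>
       s 6 = 32 + m * m + m \<and> s 7 = 0 \<and> s 8 = 32 + m * m \<and>
       (\<forall>i<m * m + m. s (32 + i) = data ! i) \<and> (\<forall>x\<ge>32 + m * m + m. s x = 0))"
    if "J 0 \<tau>" for \<tau>
  proof -
    from that have "K (m * m + m) \<tau>"
      by (simp add: J_def)
    then obtain s where \<tau>: "\<tau> = (s, rest)" and s: "s 11 = 32 + (m * m + m)"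
      and low: "\<And>x. x < 9 \<Longrightarrow> s x = start x"
      and arr: "\<And>i. i < m * m + m \<Longrightarrow> s (32 + i) = data ! i"
        "\<And>x. x \<ge> 32 + (m * m + m) \<Longrightarrow> s x = 0"
      using data by (cases \<tau>) (auto simp: K_def)
    have "s 0 = 0" "s 2 = m" "s 3 = w" "s 4 = 1" "s 7 = 0"
      using low by (simp_all add: start_def)
    then show ?thesis
      by (intro ensures_Block) (use s arr in \<open>simp_all add: effect_def \<tau> mult_2\<close>)
  qed
  show ?thesis
    unfolding setup_cmd_def
    by (rule ensures_Seq[OF 1 ensures_Seq[OF 2 ensures_Seq[OF 3 ensures_Seq[OF 4 5 order_refl]
      order_refl] order_refl]]) (simp_all add: algebra_simps)
qed

section \<open>Encoded instances and the overall time bound\<close>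

lemma length_row_major: "length (concat (map (\<lambda>i. map (f i) [0..<m]) [0..<k])) = k * m"
  by (induction k) simp_all

lemma nth_row_major:
  assumes "i < k" "j < m"
  shows "concat (map (\<lambda>i. map (f i) [0..<m]) [0..<k]) ! (i * m + j) = f i j"
  using assms(1)
proof (induction k)
  case (Suc k)
  then show ?case
    using row_major_less[of i k j m] assms(2)
    by (cases "i = k") (auto simp: nth_append length_row_major)
qed simp

text \<open>A binary tree has one inner node fewer than leaves. This is why the machine can compute
  the number of tokens from \<open>m\<close>.\<close>

lemma length_encode_cup: "length (encode_cup c) + 1 = 2 * length (leaves c)"
  by (induction c) auto

lemma set_encode_cup: "set (encode_cup c) \<subseteq> insert 0 (Suc ` set (leaves c))"
  by (induction c) auto

lemma ensures_cup_cmd: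
  assumes cup: "cup_over {..<m} c" and w: "w < m"
  shows "ensures cup_cmd (\<lambda>_. 0, encode_instance m E c C w) (200 * m ^ 3)
     (\<lambda>\<tau>. fst \<tau> 0 = of_bool (w \<in> possible_winners E C c))"
proof -
  define rows :: "nat list" where
    "rows = concat (map (\<lambda>i. map (\<lambda>j. of_bool ((i, j) \<in> E)) [0..<m]) [0..<m])"
  define data where "data = rows @ map (\<lambda>i. of_bool (i \<in> C)) [0..<m]"
  have instance_eq: "encode_instance m E c C w = m # w # data @ encode_cup c"
    by (simp add: encode_instance_def data_def rows_def)
  have m: "m > 0" using w by simp
  have len_rows: "length rows = m * m"
    by (simp add: rows_def length_row_major)
  then have len: "length data = m * m + m"
    by (simp add: data_def)
  have dist: "distinct (leaves c)" and leaves: "set (leaves c) = {..<m}"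
    using cup by (simp_all add: cup_over_def)
  then have "length (leaves c) = m"
    using distinct_card[of "leaves c"] by simp
  then have len_cup: "length (encode_cup c) = 2 * m - 1"
    using length_encode_cup[of c] by simp
  have set_cup: "set (encode_cup c) \<subseteq> {..m}"
    using set_encode_cup[of c] leaves by auto
  let ?lev = "\<lambda>v. if v \<in> possible_winners E C c then Suc 0 else 0"
  have fold: "fold (token m E C) (encode_cup c) (0, \<lambda>_. 0) = (1, ?lev)"
    using fold_token_encode_cup[of c m "\<lambda>_. 0" 0] dist leaves by simp

  define R where "R = (\<lambda>(s, ys). holds_graph m E C s \<and> holds_levels m 0 (\<lambda>_. 0) s \<and>
     s 3 = w \<and> s 5 = 2 * m - 1 \<and> ys = encode_cup c)"
  have 1: "ensures setup_cmd (\<lambda>_. 0, encode_instance m E c C w) (5 * m * m + 8 * m + 12) R"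
    unfolding instance_eq
  proof (rule ensures_weaken[OF ensures_setup_cmd[OF m len]])
    fix \<tau> :: state
    assume "case \<tau> of (s, ys) \<Rightarrow>
       ys = encode_cup c \<and> s 0 = 0 \<and> s 2 = m \<and> s 3 = w \<and> s 4 = 1 \<and> s 5 = 2 * m - 1 \<and>
       s 6 = 32 + m * m + m \<and> s 7 = 0 \<and> s 8 = 32 + m * m \<and>
       (\<forall>i<m * m + m. s (32 + i) = data ! i) \<and> (\<forall>x\<ge>32 + m * m + m. s x = 0)"
    then obtain s where \<tau>: "\<tau> = (s, encode_cup c)" and s: "s 0 = 0" "s 2 = m" "s 3 = w" "s 4 = 1"
      "s 5 = 2 * m - 1" "s 6 = 32 + m * m + m" "s 7 = 0" "s 8 = 32 + m * m"
      and arr: "\<And>i. i < m * m + m \<Longrightarrow> s (32 + i) = data ! i"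
      and zero: "\<And>x. x \<ge> 32 + m * m + m \<Longrightarrow> s x = 0"
      by (cases \<tau>) blast
    have "s (32 + i * m + j) = of_bool ((i, j) \<in> E)" if "i < m" "j < m" for i j
    proof -
      have "rows ! (i * m + j) = of_bool ((i, j) \<in> E)"
        unfolding rows_def by (rule nth_row_major[OF that])
      then show ?thesis
        using row_major_less[OF that] arr[of "i * m + j"]
        by (simp add: data_def nth_append len_rows add.assoc)
    qed
    moreover have "s (32 + m * m + j) = of_bool (j \<in> C)" if "j < m" for j
      using arr[of "m * m + j"] that by (simp add: data_def nth_append len_rows add.assoc)
    ultimately show "R \<tau>"
      using s zero by (simp add: R_def \<tau> holds_graph_def holds_levels_def)
  qed simp

  define S where "S = (\<lambda>(s, ys :: nat list). s 3 = w \<and> holds_levels m 1 ?lev s)"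
  have 2: "ensures (Repeat token_cmd 5) \<tau> ((2 * m - 1) * (m * (17 * m + 17) + 15)) S"
    if "R \<tau>" for \<tau>
  proof -
    from that obtain s where \<tau>: "\<tau> = (s, encode_cup c)" and s: "holds_graph m E C s"
      "holds_levels m 0 (\<lambda>_. 0) s" "s 3 = w" "s 5 = 2 * m - 1"
      by (cases \<tau>) (auto simp: R_def)
    have "encode_cup c \<noteq> []" by (cases c) auto
    from ensures_tokens[OF s(1,2) m this set_cup] show ?thesis
      unfolding \<tau> len_cup fold
      by (rule ensures_weaken) (use s in \<open>auto simp: S_def\<close>)
  qed
  have 3: "ensures (Block [Add 3 6 3, Load 0 3]) \<tau> 2
     (\<lambda>\<tau>. fst \<tau> 0 = of_bool (w \<in> possible_winners E C c))" if "S \<tau>" for \<tau>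
  proof -
    obtain s ys where "\<tau> = (s, ys)" by (cases \<tau>)
    with that w show ?thesis
      by (intro ensures_Block) (auto simp: S_def holds_levels_def effect_def)
  qed
  \<comment> \<open>The left side is 34 m^3 + 22 m^2 + 21 m - 1, hence below 77 m^3 for positive
    \<open>m\<close>; 200 is a generous round constant. Writing \<open>m\<close> as
    \<open>Suc n\<close> removes the truncated subtraction.\<close>
  have time: "(5 * m * m + 8 * m + 12) + ((2 * m - 1) * (m * (17 * m + 17) + 15) + 2) \<le> 200 * m ^ 3"
  proof -
    obtain n where "m = Suc n" using m by (cases m) auto
    then show ?thesis by (simp add: algebra_simps power3_eq_cube)
  qed
  show ?thesis
    unfolding cup_cmd_def
    by (rule ensures_Seq[OF 1 ensures_Seq[OF 2 3 order_refl] time]) simp_all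
qed

theorem theorem1:
  "\<exists>(P :: program) (p :: nat poly).
     \<forall>(m :: nat) (E :: nat rel) (c :: nat cup) (C :: nat set) (w :: nat).
       tournament {..<m} E \<and> cup_over {..<m} c \<and> C \<subseteq> {..<m} \<and> w \<in> {..<m} \<longrightarrow>
       (let xs = encode_instance m E c C w in
          \<exists>t \<le> poly p (length xs).
            answers_within P xs t (constructively_manipulable E c C w))"
proof (intro exI allI impI)
  fix m w :: nat and E :: "nat rel" and c :: "nat cup" and C :: "nat set"
  assume *: "tournament {..<m} E \<and> cup_over {..<m} c \<and> C \<subseteq> {..<m} \<and> w \<in> {..<m}"
  let ?xs = "encode_instance m E c C w" and ?P = "compile 0 cup_cmd"
  from * obtain t \<tau> where t: "t \<le> 200 * m ^ 3" and runs: "runs cup_cmd (\<lambda>_. 0, ?xs) t \<tau>"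
    and \<tau>: "fst \<tau> 0 = of_bool (w \<in> possible_winners E C c)"
    using ensures_cup_cmd[of m c w E C] by (auto simp: ensures_def)
  have "m \<le> length ?xs"
    by (simp add: encode_instance_def)
  then have "200 * m ^ 3 \<le> 200 * length ?xs ^ 3"
    by (intro mult_le_mono2 power_mono) auto
  with t have "t \<le> 200 * length ?xs ^ 3"
    by linarith
  then have "t \<le> poly (monom 200 3) (length ?xs)"
    by (simp add: poly_monom)
  \<comment> \<open>With no surrounding code the final program counter is the program length, so the
    machine has halted.\<close>
  moreover have "(step ?P ^^ t) (initial ?xs) = (length ?P, \<tau>)"
    using compile_correct[OF runs, of "[]" "[]"] by (simp add: initial_def)
  then have "answers_within ?P ?xs t (constructively_manipulable E c C w)"
    using \<tau> constructively_manipulable_iff[of "{..<m}" E c C w] *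
    by (simp add: answers_within_def halted_def)
  ultimately show "let xs = ?xs in \<exists>t \<le> poly (monom 200 3) (length xs).
      answers_within ?P xs t (constructively_manipulable E c C w)"
    by (auto simp: Let_def)
qed

end
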